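(* Let $p,q\in\mathbb{C}$ be nonzero with $|p|^2+|q|^2=1$, and let $$X=\begin{pmatrix} p & p\\ q & -q\end{pmatrix}.$$ Let $(v_1,v_2)$ be an orthonormal basis of a two-dimensional complex Hilbert space, let $v'_j=\sum_{i=1}^2 X_{ij}v_i$ for $j=1,2$, and let $(\tilde v'_1,\tilde v'_2)$ be the reciprocal basis of $(v'_1,v'_2)$. For a vector $u$ define $$P(v'_j|u)=\frac12\Big(\langle u|v'_j\rangle\langle \tilde v'_j|u\rangle+\langle u|\tilde v'_j\rangle\langle v'_j|u\rangle\Big),\qquad j=1,2.$$ If for all $\lambda=(\lambda_1,\lambda_2)\in\mathbb{C}^2$ and all $j\in\{1,2\}$ one has $\mathrm{Re}\,P(v'_j|u)\ge 0$ for $u=\lambda_1v_1+\lambda_2v_2$, then $X$ is unitary.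
   Context: Inner products $\langle\cdot|\cdot\rangle$ are conjugate-linear in the first argument and linear in the second. The reciprocal basis of $(v'_1,v'_2)$ is the unique basis with $\langle\tilde v'_i|v'_j\rangle=\delta_{ij}$; explicitly $\tilde v'_j=\sum_i \overline{(X^{-1})_{ji}}\,v_i$. The matrix $X$ is the "neutral meson matrix" under CPT invariance: its columns are the coordinates, in the orthonormal flavour basis, of the two normalized eigenvectors of the effective $2\times2$ Hamiltonian. *)

theory Defs
  imports "HOL-Analysis.Analysis"
begin

text \<open>
  The inner product is linear in the second argument; conjugate-linearity in the first argument
  and reality of \<open>inner x x\<close> follow from \<open>inner_cnj_commute\<close>.
\<close>

locale complex_inner_space = vector_space scale
  for scale :: "complex \<Rightarrow> 'h::ab_group_add \<Rightarrow> 'h" (infixr "*\<^sub>C" 75) +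
  fixes inner :: "'h \<Rightarrow> 'h \<Rightarrow> complex" ("\<langle>_ | _\<rangle>")
  assumes inner_add_right: "\<langle>x | y + z\<rangle> = \<langle>x | y\<rangle> + \<langle>x | z\<rangle>"
    and inner_scale_right: "\<langle>x | c *\<^sub>C y\<rangle> = c * \<langle>x | y\<rangle>"
    and inner_cnj_commute: "\<langle>y | x\<rangle> = cnj \<langle>x | y\<rangle>"
    and inner_pos: "x \<noteq> 0 \<Longrightarrow> 0 < Re \<langle>x | x\<rangle>"
begin

definition hnorm :: "'h \<Rightarrow> real" where
  "hnorm x = sqrt (Re \<langle>x | x\<rangle>)"

definition basis_family :: "('i::finite \<Rightarrow> 'h) \<Rightarrow> bool" where
  "basis_family v \<longleftrightarrow> inj v \<and> independent (range v) \<and> span (range v) = UNIV"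

definition orthonormal_basis :: "('i::finite \<Rightarrow> 'h) \<Rightarrow> bool" where
  "orthonormal_basis v \<longleftrightarrow>
     basis_family v \<and> (\<forall>i j. \<langle>v i | v j\<rangle> = (if i = j then 1 else 0))"

text \<open>
  The reciprocal basis is only meaningful if \<open>v\<close> is a basis of the (finite-dimensional) space;
  in that case the description below has exactly one solution.
\<close>

definition reciprocal_basis :: "('i::finite \<Rightarrow> 'h) \<Rightarrow> 'i \<Rightarrow> 'h" where
  "reciprocal_basis v =
     (THE w. basis_family w \<and> (\<forall>i j. \<langle>w i | v j\<rangle> = (if i = j then 1 else 0)))"

text \<open>\<open>P_basis v j u\<close> stands for $P(v_j|u)$, which depends on the whole basis \<open>v\<close>
  through the reciprocal vector of \<open>v j\<close>.\<close>

definition P_basis :: "('i::finite \<Rightarrow> 'h) \<Rightarrow> 'i \<Rightarrow> 'h \<Rightarrow> complex" where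
  "P_basis v j u =
     1 / 2 * (\<langle>u | v j\<rangle> * \<langle>reciprocal_basis v j | u\<rangle>
            + \<langle>u | reciprocal_basis v j\<rangle> * \<langle>v j | u\<rangle>)"

end

locale complex_hilbert_space = complex_inner_space +
  assumes complete:
    "(\<forall>e>0. \<exists>N. \<forall>m\<ge>N. \<forall>n\<ge>N. hnorm (f m - f n) < e) \<Longrightarrow>
     \<exists>l. (\<lambda>n. hnorm (f n - l)) \<longlonglongrightarrow> 0"

definition conj_transpose :: "complex^'n^'m \<Rightarrow> complex^'m^'n" where
  "conj_transpose A = (\<chi> i j. cnj (A $ j $ i))"

definition unitary_matrix :: "complex^'n^'n \<Rightarrow> bool" where
  "unitary_matrix A \<longleftrightarrow>
     conj_transpose A ** A = mat 1 \<and> A ** conj_transpose A = mat 1"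

end

theory Submission
  imports Defs
begin

text \<open>
  For \<open>u = l1 v 1 + l2 v 2\<close> the real part of \<open>P(v' 1 | u)\<close> is half of
  \<open>|l1|\<^sup>2 + |l2|\<^sup>2 + Re (cnj l1 * l2 * p / q + cnj l2 * l1 * q / p)\<close>. Choosing the phases of
  \<open>l1 = p |q|\<close> and \<open>l2 = - q |p|\<close> to make both cross terms negative, this becomes
  \<open>- |p| |q| (|p| - |q|)\<^sup>2 / 2\<close>, so nonnegativity forces \<open>|p| = |q|\<close>; together with
  the normalization this is unitarity of \<open>X\<close>.
\<close>

context complex_inner_space
begin

lemma inner_add_left: "\<langle>x + y | z\<rangle> = \<langle>x | z\<rangle> + \<langle>y | z\<rangle>"
  by (metis inner_cnj_commute inner_add_right complex_cnj_add)

lemma inner_scale_left: "\<langle>c *\<^sub>C x | y\<rangle> = cnj c * \<langle>x | y\<rangle>"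
  by (metis inner_cnj_commute inner_scale_right complex_cnj_mult)

lemma inner_zero_right: "\<langle>x | 0\<rangle> = 0"
  using inner_add_right[of x 0 0] by simp

lemma inner_diff_left: "\<langle>x - y | z\<rangle> = \<langle>x | z\<rangle> - \<langle>y | z\<rangle>"
  using inner_add_left[of "x - y" y z] by simp

lemma inner_span_eq_0:
  assumes "y \<in> span S" and "\<And>s. s \<in> S \<Longrightarrow> \<langle>x | s\<rangle> = 0"
  shows "\<langle>x | y\<rangle> = 0"
  using assms(1)
  by (induction rule: span_induct_alt)
    (simp_all add: inner_zero_right inner_add_right inner_scale_right assms(2))

text \<open>A \<open>v k\<close> in the span of the other vectors would be orthogonal to
  \<open>w k\<close>, which is orthogonal to all of those, contradicting the value 1 of their
  pairing.\<close>

lemma basis_family_if_biorthogonal: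
  fixes v w :: "'i::finite \<Rightarrow> 'h"
  assumes biorth: "\<And>i j. \<langle>w i | v j\<rangle> = (if i = j then 1 else 0)"
    and span: "span (range v) = UNIV"
  shows "basis_family v"
proof -
  have inj: "inj v"
  proof (rule injI)
    fix i j assume "v i = v j"
    then show "i = j"
      using biorth[of i i] biorth[of i j] by (auto split: if_splits)
  qed
  have "v k \<notin> span (range v - {v k})" for k
  proof
    assume "v k \<in> span (range v - {v k})"
    then have "\<langle>w k | v k\<rangle> = 0"
      by (rule inner_span_eq_0) (auto simp: biorth)
    then show False
      by (simp add: biorth)
  qed
  then have "independent (range v)"
    by (auto simp: dependent_def)
  with inj span show ?thesis
    by (simp add: basis_family_def)
qed

text \<open>Evaluates the \<open>THE\<close> from an explicit candidate. Uniqueness: the difference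
  of two candidates is orthogonal to every \<open>v j\<close>, hence to the whole space and so to
  itself.\<close>

lemma reciprocal_basis_eqI:
  fixes v w :: "'i::finite \<Rightarrow> 'h"
  assumes biorth: "\<And>i j. \<langle>w i | v j\<rangle> = (if i = j then 1 else 0)"
    and span_v: "span (range v) = UNIV" and span_w: "span (range w) = UNIV"
  shows "reciprocal_basis v = w"
  unfolding reciprocal_basis_def
proof (rule the_equality, intro conjI allI)
  \<comment> \<open>Biorthogonality survives conjugation, so the basis criterion applies with the
    roles of \<open>v\<close> and \<open>w\<close> exchanged.\<close>
  have "\<langle>v i | w j\<rangle> = (if i = j then 1 else 0)" for i j
    using inner_cnj_commute[of "v i" "w j"] by (simp add: biorth)
  then show "basis_family w"
    using span_w by (rule basis_family_if_biorthogonal)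
  show "\<langle>w i | v j\<rangle> = (if i = j then 1 else 0)" for i j
    by (rule biorth)
next
  fix w' :: "'i \<Rightarrow> 'h"
  assume w': "basis_family w' \<and> (\<forall>i j. \<langle>w' i | v j\<rangle> = (if i = j then 1 else 0))"
  show "w' = w"
  proof
    fix i
    have "w' i - w i \<in> span (range v)"
      by (simp add: span_v)
    then have "\<langle>w' i - w i | w' i - w i\<rangle> = 0"
      by (rule inner_span_eq_0) (auto simp: inner_diff_left biorth w')
    then show "w' i = w i"
      using inner_pos[of "w' i - w i"] by fastforce
  qed
qed

lemma inner_orthonormal_2:
  fixes v :: "2 \<Rightarrow> 'h"
  assumes "orthonormal_basis v"
  shows "\<langle>a *\<^sub>C v 1 + b *\<^sub>C v 2 | c *\<^sub>C v 1 + d *\<^sub>C v 2\<rangle> = cnj a * c + cnj b * d"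
  using assms
  by (simp add: orthonormal_basis_def inner_add_left inner_add_right inner_scale_left
      inner_scale_right)

text \<open>Scaled sum and difference of \<open>w 1\<close> and \<open>w 2\<close> recover
  \<open>v 1\<close> and \<open>v 2\<close>. The coefficients are generic because \<open>v'\<close>
  and its reciprocal basis both have this shape.\<close>

lemma span_add_diff_eq_UNIV:
  fixes v w :: "2 \<Rightarrow> 'h"
  assumes v: "span (range v) = UNIV" and "a \<noteq> 0" "b \<noteq> 0"
    and w1: "w 1 = a *\<^sub>C v 1 + b *\<^sub>C v 2" and w2: "w 2 = a *\<^sub>C v 1 + (- b) *\<^sub>C v 2"
  shows "span (range w) = UNIV"
proof -
  have "v 1 = (1 / (2 * a)) *\<^sub>C (w 1 + w 2)" "v 2 = (1 / (2 * b)) *\<^sub>C (w 1 - w 2)"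
    using assms(2,3)
    by (simp_all add: w1 w2 algebra_simps flip: scale_left_distrib)
  moreover have "w 1 + w 2 \<in> span (range w)" "w 1 - w 2 \<in> span (range w)"
    by (auto intro!: span_add span_diff intro: span_base)
  ultimately have "v i \<in> span (range w)" for i
    using exhaust_2[of i] by (auto intro: span_scale)
  then have "range v \<subseteq> span (range w)"
    by blast
  then have "span (range v) \<subseteq> span (range w)"
    by (simp add: span_minimal subspace_span)
  then show ?thesis
    using v by auto
qed

text \<open>The coefficients are the conjugated first row of the inverse of \<open>X\<close>, whose
  rows are \<open>(1/(2p), 1/(2q))\<close> and \<open>(1/(2p), -1/(2q))\<close>.\<close>

lemma reciprocal_basis_add_diff:
  fixes v w :: "2 \<Rightarrow> 'h"
  assumes v: "orthonormal_basis v" and "p \<noteq> 0" "q \<noteq> 0"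
    and w1: "w 1 = p *\<^sub>C v 1 + q *\<^sub>C v 2" and w2: "w 2 = p *\<^sub>C v 1 + (- q) *\<^sub>C v 2"
  shows "reciprocal_basis w 1 = (1 / (2 * cnj p)) *\<^sub>C v 1 + (1 / (2 * cnj q)) *\<^sub>C v 2"
proof -
  \<comment> \<open>Both vectors are needed here: being reciprocal is a property of the whole
    family.\<close>
  define r :: "2 \<Rightarrow> 'h" where "r j = (1 / (2 * cnj p)) *\<^sub>C v 1 +
    (if j = 1 then 1 / (2 * cnj q) else - (1 / (2 * cnj q))) *\<^sub>C v 2" for j
  have span_v: "span (range v) = UNIV"
    using v by (simp add: orthonormal_basis_def basis_family_def)
  have "reciprocal_basis w = r"
  proof (rule reciprocal_basis_eqI)
    show "span (range w) = UNIV"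
      using span_v assms(2,3) w1 w2 by (rule span_add_diff_eq_UNIV)
    show "span (range r) = UNIV"
      by (rule span_add_diff_eq_UNIV[OF span_v, of "1 / (2 * cnj p)" "1 / (2 * cnj q)"])
        (use assms(2,3) in \<open>simp_all add: r_def\<close>)
    show "\<langle>r i | w j\<rangle> = (if i = j then 1 else 0)" for i j
      using exhaust_2[of i] exhaust_2[of j] assms(2,3)
      by (auto simp: r_def w1 w2 inner_orthonormal_2[OF v] simp del: scale_minus_left)
  qed
  then show ?thesis
    by (simp add: r_def)
qed

end

lemma unitary_matrix_add_diff:
  assumes "(cmod p)\<^sup>2 = 1 / 2" and "(cmod q)\<^sup>2 = 1 / 2"
  shows "unitary_matrix (vector [vector [p, p], vector [q, - q]] :: complex^2^2)"
proof -
  have eqs: "p * cnj p = 1 / 2" "q * cnj q = 1 / 2"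
    by (simp_all add: assms flip: complex_norm_square)
  \<comment> \<open>The two matrix products in \<open>unitary_matrix\<close> produce the factors in
    opposite orders.\<close>
  then have "cnj p * p = 1 / 2" "cnj q * q = 1 / 2"
    by (simp_all only: mult.commute)
  note eqs = eqs this
  show ?thesis
    by (simp add: eqs unitary_matrix_def conj_transpose_def matrix_matrix_mult_def mat_def
        vec_eq_iff forall_2 sum_2)
qed

theorem proposition3p3:
  fixes scale :: "complex \<Rightarrow> 'h::ab_group_add \<Rightarrow> 'h"
    and inner :: "'h \<Rightarrow> 'h \<Rightarrow> complex"
    and p q :: complex
    and X :: "complex^2^2"
    and v v' :: "2 \<Rightarrow> 'h"
  assumes hilbert: "complex_hilbert_space scale inner"
    and dim2: "vector_space.dim scale (UNIV :: 'h set) = 2"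
    and "p \<noteq> 0" and "q \<noteq> 0" and "(cmod p)\<^sup>2 + (cmod q)\<^sup>2 = 1"
    and X: "X = vector [vector [p, p], vector [q, - q]]"
    and v: "complex_inner_space.orthonormal_basis scale inner v"
    and v': "\<And>j. v' j = (\<Sum>i\<in>UNIV. scale (X $ i $ j) (v i))"
    and P_nonneg: "\<And>(l1::complex) (l2::complex) (j::2).
      0 \<le> Re (complex_inner_space.P_basis scale inner v' j (scale l1 (v 1) + scale l2 (v 2)))"
  shows "unitary_matrix X"
proof -
  interpret complex_hilbert_space scale inner
    by (rule hilbert)
  have v'1: "v' 1 = scale p (v 1) + scale q (v 2)"
    and v'2: "v' 2 = scale p (v 1) + scale (- q) (v 2)"
    by (simp_all add: v' X sum_2)
  note recip = reciprocal_basis_add_diff[where w = v', OF v \<open>p \<noteq> 0\<close> \<open>q \<noteq> 0\<close> v'1 v'2]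
  define a b where "a = cmod p" and "b = cmod q"
  have "a > 0" "b > 0"
    using \<open>p \<noteq> 0\<close> \<open>q \<noteq> 0\<close> by (simp_all add: a_def b_def)
  have pp: "cnj p * p = of_real (a\<^sup>2)" and qq: "cnj q * q = of_real (b\<^sup>2)"
    by (simp_all only: a_def b_def complex_norm_square mult.commute)
  \<comment> \<open>Pairing this \<open>u\<close> with \<open>v' 1\<close> gives
    \<open>cnj p * p * b - cnj q * q * a\<close>, and with the reciprocal vector
    \<open>(b - a) / 2\<close>. Both are real, so the two conjugate summands of
    \<open>P_basis\<close> coincide.\<close>
  have "P_basis v' 1 (scale (p * of_real b) (v 1) + scale (- q * of_real a) (v 2)) =
      (cnj p * p * b - cnj q * q * a) * (b - a) / 2"
    using \<open>p \<noteq> 0\<close> \<open>q \<noteq> 0\<close>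
    by (simp add: P_basis_def recip v'1 inner_orthonormal_2[OF v] field_simps
        del: scale_minus_left)
  also have "\<dots> = of_real ((a\<^sup>2 * b - b\<^sup>2 * a) * (b - a) / 2)"
    by (simp add: pp qq)
  also have "(a\<^sup>2 * b - b\<^sup>2 * a) * (b - a) / 2 = - (a * b * (a - b)\<^sup>2 / 2)"
    by (simp add: power2_eq_square field_simps)
  finally have "a * b * (a - b)\<^sup>2 \<le> 0"
    \<comment> \<open>Here \<open>1\<close> is the index \<open>j\<close>; the other two terms are
      the coordinates of \<open>u\<close>.\<close>
    using P_nonneg[of 1 "p * of_real b" "- q * of_real a"] by simp
  then have "a = b"
    using \<open>a > 0\<close> \<open>b > 0\<close> by (simp add: mult_le_0_iff)
  then show ?thesis
    using \<open>(cmod p)\<^sup>2 + (cmod q)\<^sup>2 = 1\<close> unitary_matrix_add_diff[of p q]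
    by (simp add: X a_def b_def)
qed

end
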